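(* Let $d\ge 2$ be an integer, let $M$ be a non-zero $d$-CP monoid, and let $N$ be any finite monoid. Then there is an injective monoid homomorphism from $N$ into $M$.
   Context: A monoid is non-zero if it has more than one element. For $d\in\mathbb{N}$, a $d$-CP (categorical $d$-fold product) monoid is a monoid $M$ with distinguished elements $\tau_1,\dots,\tau_d\in M$ and a bijective function $\Phi:M^d\to M$ such that $\tau_i\Phi(m_1,\dots,m_d)=m_i$ for all $m_1,\dots,m_d\in M$ and $1\le i\le d$. Monoid homomorphisms take $1$ to $1$. *)

theory Defs
  imports "HOL-Algebra.Group"
begin

definition nonzero_monoid :: "('a, 'm) monoid_scheme \<Rightarrow> bool" where
  "nonzero_monoid M \<longleftrightarrow> (\<exists>x \<in> carrier M. \<exists>y \<in> carrier M. x \<noteq> y)"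

(* The power M^d is the set of extensional functions on {1..d} with values in the carrier. *)
locale cp_monoid = monoid M for M :: "('a, 'm) monoid_scheme" (structure) +
  fixes d :: nat and \<tau> :: "nat \<Rightarrow> 'a" and \<Phi> :: "(nat \<Rightarrow> 'a) \<Rightarrow> 'a"
  assumes tau_closed: "i \<in> {1..d} \<Longrightarrow> \<tau> i \<in> carrier M"
    and Phi_bij: "bij_betw \<Phi> ({1..d} \<rightarrow>\<^sub>E carrier M) (carrier M)"
    and tau_Phi: "m \<in> {1..d} \<rightarrow>\<^sub>E carrier M \<Longrightarrow> i \<in> {1..d} \<Longrightarrow> \<tau> i \<otimes> \<Phi> m = m i"

(* The set hom does not require the unit to be preserved, so this is added. *)
definition monoid_hom :: "('a, 'm) monoid_scheme \<Rightarrow> ('b, 'n) monoid_scheme \<Rightarrow> ('a \<Rightarrow> 'b) set" where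
  "monoid_hom G H = {h \<in> hom G H. h \<one>\<^bsub>G\<^esub> = \<one>\<^bsub>H\<^esub>}"

end

theory Submission
  imports Defs
begin

text \<open>
  In a \<open>d\<close>-CP monoid \<open>M\<close> the map \<open>x \<mapsto> (\<tau>\<^sub>1 x, \<dots>, \<tau>\<^sub>d x)\<close> is a bijection \<open>M \<rightarrow> M\<^sup>d\<close>, so an
  element is the same thing as its tuple of coordinates. Splitting every coordinate again turns
  \<open>M \<cong> M\<^sup>d\<close> into \<open>M \<cong> M\<^sup>n\<close> for arbitrarily large \<open>n\<close>, still given by left multiplication with \<open>n\<close>
  fixed elements. A set \<open>S\<close> of elements whose left multiplications give such a bijection is
  called a coordinate set below; since \<open>d \<ge> 2\<close> and \<open>M\<close> is non-zero, there are finite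
  coordinate sets of size beyond any given bound (lemma \<open>ex_large_coordinate_set\<close>).

  A self-map \<open>f\<close> of a coordinate set \<open>S\<close> is realised by the unique \<open>x\<close> with \<open>s x = f s\<close> for
  all \<open>s \<in> S\<close>. If \<open>f\<close> and \<open>g\<close> are realised by \<open>x\<close> and \<open>y\<close>, then \<open>s (x y) = (f s) y = g (f s)\<close>:
  multiplication in \<open>M\<close> is composition of maps written on the right. Every right action of a
  monoid \<open>N\<close> on \<open>S\<close> is thereby a homomorphism \<open>N \<rightarrow> M\<close>, injective when the action is faithful
  (lemma \<open>faithful_right_action_embeds\<close>). Once \<open>S\<close> has at least as many elements as \<open>N\<close>, the
  regular right action of \<open>N\<close> can be copied into \<open>S\<close> and extended by fixed points, and it is
  faithful because \<open>1 \<cdot> a = a\<close>.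
\<close>

definition coordinate_set :: "('a, 'm) monoid_scheme \<Rightarrow> 'a set \<Rightarrow> bool" where
  "coordinate_set M S \<longleftrightarrow> S \<subseteq> carrier M \<and>
    (\<forall>m \<in> S \<rightarrow> carrier M. \<exists>!x. x \<in> carrier M \<and> (\<forall>s\<in>S. s \<otimes>\<^bsub>M\<^esub> x = m s))"

lemma coordinate_set_ex:
  assumes "coordinate_set M S" "m \<in> S \<rightarrow> carrier M"
  obtains x where "x \<in> carrier M" "\<And>s. s \<in> S \<Longrightarrow> s \<otimes>\<^bsub>M\<^esub> x = m s"
  using assms unfolding coordinate_set_def by blast

lemma coordinate_set_eqI:
  assumes S: "coordinate_set M S" and M: "monoid M"
    and x: "x \<in> carrier M" and y: "y \<in> carrier M"
    and eq: "\<And>s. s \<in> S \<Longrightarrow> s \<otimes>\<^bsub>M\<^esub> x = s \<otimes>\<^bsub>M\<^esub> y"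
  shows "x = y"
proof -
  have "(\<lambda>s. s \<otimes>\<^bsub>M\<^esub> y) \<in> S \<rightarrow> carrier M"
    using S y monoid.m_closed[OF M] unfolding coordinate_set_def by blast
  then have "\<exists>!z. z \<in> carrier M \<and> (\<forall>s\<in>S. s \<otimes>\<^bsub>M\<^esub> z = s \<otimes>\<^bsub>M\<^esub> y)"
    by (rule bspec[OF conjunct2[OF S[unfolded coordinate_set_def]]])
  then show ?thesis using x y eq by blast
qed

lemma (in monoid) coordinate_set_one: "coordinate_set G {\<one>}"
  unfolding coordinate_set_def by (auto simp: Pi_def intro!: ex1I)

context cp_monoid
begin

lemma tau_jointly_injective:
  assumes x: "x \<in> carrier M" and y: "y \<in> carrier M"
    and eq: "\<And>i. i \<in> {1..d} \<Longrightarrow> \<tau> i \<otimes> x = \<tau> i \<otimes> y"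
  shows "x = y"
proof -
  obtain m where m: "m \<in> {1..d} \<rightarrow>\<^sub>E carrier M" "x = \<Phi> m"
    using x Phi_bij unfolding bij_betw_def by blast
  obtain n where n: "n \<in> {1..d} \<rightarrow>\<^sub>E carrier M" "y = \<Phi> n"
    using y Phi_bij unfolding bij_betw_def by blast
  have "m i = n i" if "i \<in> {1..d}" for i
    using eq[OF that] tau_Phi[OF m(1) that] tau_Phi[OF n(1) that] m(2) n(2) by simp
  then have "m = n" by (rule PiE_ext[OF m(1) n(1)])
  with m n show ?thesis by simp
qed

text \<open>
  Prescribing the coordinates doubly indexed by \<open>i\<close> and \<open>s\<close>, rather than by the products
  \<open>\<tau> i \<otimes> s\<close>, makes it possible to conclude afterwards that these products are distinct.
\<close>

lemma refined_coordinates_ex: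
  assumes S: "coordinate_set M S"
    and m: "\<And>i s. i \<in> {1..d} \<Longrightarrow> s \<in> S \<Longrightarrow> m i s \<in> carrier M"
  shows "\<exists>x \<in> carrier M. \<forall>i \<in> {1..d}. \<forall>s \<in> S. (\<tau> i \<otimes> s) \<otimes> x = m i s"
proof -
  let ?r = "\<lambda>s. restrict (\<lambda>i. m i s) {1..d}"
  have r: "?r s \<in> {1..d} \<rightarrow>\<^sub>E carrier M" if "s \<in> S" for s
    using m that by auto
  then have "(\<lambda>s. \<Phi> (?r s)) \<in> S \<rightarrow> carrier M"
    using bij_betwE[OF Phi_bij] by blast
  then obtain x where x: "x \<in> carrier M" "\<And>s. s \<in> S \<Longrightarrow> s \<otimes> x = \<Phi> (?r s)"
    by (rule coordinate_set_ex[OF S]) blast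
  have "(\<tau> i \<otimes> s) \<otimes> x = m i s" if i: "i \<in> {1..d}" and s: "s \<in> S" for i s
  proof -
    have "s \<in> carrier M" using S s unfolding coordinate_set_def by blast
    then have "(\<tau> i \<otimes> s) \<otimes> x = \<tau> i \<otimes> \<Phi> (?r s)"
      using m_assoc tau_closed[OF i] x s by simp
    also have "\<dots> = m i s" using tau_Phi[OF r[OF s] i] i by simp
    finally show ?thesis .
  qed
  then show ?thesis by (intro bexI[OF _ x(1)] ballI)
qed

text \<open>
  This is the composition of the bijections \<open>M \<rightarrow> M\<^sup>S\<close> and \<open>M\<^sup>S \<rightarrow> (M\<^sup>d)\<^sup>S\<close>, since the \<open>i\<close>-th
  component of the coordinate \<open>s x\<close> is \<open>\<tau> i (s x) = (\<tau> i s) x\<close>.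
\<close>

lemma coordinate_set_refine:
  assumes S: "coordinate_set M S"
  shows "coordinate_set M ((\<lambda>(i, s). \<tau> i \<otimes> s) ` ({1..d} \<times> S))" (is "coordinate_set M ?T")
proof -
  have SM: "S \<subseteq> carrier M" using S unfolding coordinate_set_def by blast
  have TM: "?T \<subseteq> carrier M" using SM tau_closed by auto
  have inT: "\<tau> i \<otimes> s \<in> ?T" if "i \<in> {1..d}" "s \<in> S" for i s
    using that by force
  have "\<exists>!x. x \<in> carrier M \<and> (\<forall>t\<in>?T. t \<otimes> x = m t)" if m: "m \<in> ?T \<rightarrow> carrier M" for m
  proof -
    have "\<exists>x \<in> carrier M. \<forall>i \<in> {1..d}. \<forall>s \<in> S. (\<tau> i \<otimes> s) \<otimes> x = m (\<tau> i \<otimes> s)"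
      by (rule refined_coordinates_ex[OF S]) (rule funcset_mem[OF m inT])
    then obtain x where x: "x \<in> carrier M"
      "\<forall>i \<in> {1..d}. \<forall>s \<in> S. (\<tau> i \<otimes> s) \<otimes> x = m (\<tau> i \<otimes> s)" ..
    have xm: "(\<tau> i \<otimes> s) \<otimes> x = m (\<tau> i \<otimes> s)" if "i \<in> {1..d}" "s \<in> S" for i s
      using x(2) that by blast
    show ?thesis
    proof (rule ex1I[of _ x])
      show "x \<in> carrier M \<and> (\<forall>t\<in>?T. t \<otimes> x = m t)" using x(1) xm by auto
    next
      fix y assume y: "y \<in> carrier M \<and> (\<forall>t\<in>?T. t \<otimes> y = m t)"
      then have yM: "y \<in> carrier M" ..
      show "y = x"
      proof (rule coordinate_set_eqI[OF S monoid_axioms])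
        fix s assume s: "s \<in> S"
        then have sM: "s \<in> carrier M" using SM by blast
        show "s \<otimes> y = s \<otimes> x"
        proof (rule tau_jointly_injective)
          fix i assume i: "i \<in> {1..d}"
          have "(\<tau> i \<otimes> s) \<otimes> y = m (\<tau> i \<otimes> s)"
            using conjunct2[OF y] inT[OF i s] by (rule bspec)
          then have "(\<tau> i \<otimes> s) \<otimes> y = (\<tau> i \<otimes> s) \<otimes> x" using xm[OF i s] by simp
          then show "\<tau> i \<otimes> (s \<otimes> y) = \<tau> i \<otimes> (s \<otimes> x)"
            using m_assoc tau_closed[OF i] sM x(1) yM by simp
        qed (use sM x(1) yM in auto)
      qed (use x(1) yM in auto)
    qed
  qed
  with TM show ?thesis unfolding coordinate_set_def by (intro conjI ballI)
qed

text \<open>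
  With two different values available, some \<open>x\<close> has one of them as its coordinate at a chosen index pair
  and the other at all remaining pairs; equal products would give equal coordinates of \<open>x\<close>.
\<close>

lemma inj_on_refine:
  assumes S: "coordinate_set M S" and nz: "nonzero_monoid M"
  shows "inj_on (\<lambda>(i, s). \<tau> i \<otimes> s) ({1..d} \<times> S)"
proof (rule inj_onI, clarify)
  fix i s j t
  assume ij: "i \<in> {1..d}" "j \<in> {1..d}" and st: "s \<in> S" "t \<in> S"
    and eq: "\<tau> i \<otimes> s = \<tau> j \<otimes> t"
  obtain a b where ab: "a \<in> carrier M" "b \<in> carrier M" "a \<noteq> b"
    using nz unfolding nonzero_monoid_def by blast
  define m where "m = (\<lambda>k u. if (k, u) = (i, s) then a else b)"
  have "m k u \<in> carrier M" for k u
    using ab unfolding m_def by simp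
  from refined_coordinates_ex[OF S this] obtain x
    where "\<forall>k \<in> {1..d}. \<forall>u \<in> S. (\<tau> k \<otimes> u) \<otimes> x = m k u" ..
  then have "(\<tau> i \<otimes> s) \<otimes> x = m i s" "(\<tau> j \<otimes> t) \<otimes> x = m j t" using ij st by blast+
  then have "m i s = m j t" using eq by simp
  then show "i = j \<and> s = t" using ab(3) unfolding m_def by (auto split: if_splits)
qed

lemma ex_large_coordinate_set:
  assumes d: "d \<ge> 2" and nz: "nonzero_monoid M"
  shows "\<exists>S. coordinate_set M S \<and> finite S \<and> card S > n"
proof (induction n)
  case 0
  show ?case using coordinate_set_one by (intro exI[of _ "{\<one>}"]) auto
next
  case (Suc n)
  then obtain S where S: "coordinate_set M S" "finite S" "card S > n" by blast
  let ?T = "(\<lambda>(i, s). \<tau> i \<otimes> s) ` ({1..d} \<times> S)"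
  have "card ?T = d * card S"
    using card_image[OF inj_on_refine[OF S(1) nz]] by (simp add: card_cartesian_product)
  moreover have "2 * card S \<le> d * card S" using d by simp
  ultimately have "card ?T > Suc n" using S(3) by linarith
  moreover have "finite ?T" using S(2) by simp
  ultimately show ?case using coordinate_set_refine[OF S(1)] by (intro exI[of _ ?T] conjI)
qed

end

text \<open>
  The action has to be on the right for the homomorphism not to reverse products: acting by
  \<open>a \<otimes> b\<close> means acting by \<open>a\<close> first, and this is the order in which the factors of \<open>x y\<close> meet
  a coordinate \<open>s\<close> in \<open>s (x y) = (s x) y\<close>.
\<close>

lemma faithful_right_action_embeds:
  fixes M :: "('a, 'm) monoid_scheme" and N :: "('b, 'n) monoid_scheme"
  assumes M: "monoid M" and N: "monoid N" and S: "coordinate_set M S"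
    and act: "\<And>a s. a \<in> carrier N \<Longrightarrow> s \<in> S \<Longrightarrow> act a s \<in> S"
    and act_one: "\<And>s. s \<in> S \<Longrightarrow> act \<one>\<^bsub>N\<^esub> s = s"
    and act_mult: "\<And>a b s. a \<in> carrier N \<Longrightarrow> b \<in> carrier N \<Longrightarrow> s \<in> S
                     \<Longrightarrow> act (a \<otimes>\<^bsub>N\<^esub> b) s = act b (act a s)"
    and faithful: "\<And>a b. a \<in> carrier N \<Longrightarrow> b \<in> carrier N
                     \<Longrightarrow> (\<And>s. s \<in> S \<Longrightarrow> act a s = act b s) \<Longrightarrow> a = b"
  shows "\<exists>h. h \<in> monoid_hom N M \<and> inj_on h (carrier N)"
proof -
  interpret M: monoid M by (rule M)
  interpret N: monoid N by (rule N)
  have SM: "s \<in> carrier M" if "s \<in> S" for s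
    using S that unfolding coordinate_set_def by blast
  have "\<exists>x. x \<in> carrier M \<and> (\<forall>s\<in>S. s \<otimes>\<^bsub>M\<^esub> x = act a s)" if "a \<in> carrier N" for a
  proof -
    have "act a \<in> S \<rightarrow> carrier M" using act[OF that] SM by blast
    then show ?thesis by (rule coordinate_set_ex[OF S]) blast
  qed
  then obtain h where h: "\<And>a. a \<in> carrier N \<Longrightarrow> h a \<in> carrier M"
    and hs: "\<And>a s. a \<in> carrier N \<Longrightarrow> s \<in> S \<Longrightarrow> s \<otimes>\<^bsub>M\<^esub> h a = act a s"
    by metis
  have "h (a \<otimes>\<^bsub>N\<^esub> b) = h a \<otimes>\<^bsub>M\<^esub> h b" if ab: "a \<in> carrier N" "b \<in> carrier N" for a b
  proof (rule coordinate_set_eqI[OF S M])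
    fix s assume s: "s \<in> S"
    have "s \<otimes>\<^bsub>M\<^esub> (h a \<otimes>\<^bsub>M\<^esub> h b) = act a s \<otimes>\<^bsub>M\<^esub> h b"
      using M.m_assoc[OF SM[OF s] h[OF ab(1)] h[OF ab(2)]] hs[OF ab(1) s] by simp
    also have "\<dots> = act b (act a s)" by (rule hs[OF ab(2) act[OF ab(1) s]])
    finally show "s \<otimes>\<^bsub>M\<^esub> h (a \<otimes>\<^bsub>N\<^esub> b) = s \<otimes>\<^bsub>M\<^esub> (h a \<otimes>\<^bsub>M\<^esub> h b)"
      using hs[OF N.m_closed[OF ab] s] act_mult[OF ab s] by simp
  qed (use h ab in auto)
  moreover have "h \<one>\<^bsub>N\<^esub> = \<one>\<^bsub>M\<^esub>"
    by (rule coordinate_set_eqI[OF S M]) (use h hs SM act_one in auto)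
  ultimately have "h \<in> monoid_hom N M"
    using h unfolding monoid_hom_def hom_def by auto
  moreover have "inj_on h (carrier N)"
  proof (rule inj_onI)
    fix a b assume ab: "a \<in> carrier N" "b \<in> carrier N" and eq: "h a = h b"
    have "act a s = act b s" if "s \<in> S" for s
      using hs[OF ab(1) that] hs[OF ab(2) that] eq by simp
    then show "a = b" by (rule faithful[OF ab])
  qed
  ultimately show ?thesis by blast
qed

theorem theorem6:
  fixes M :: "('a, 'm) monoid_scheme" and N :: "('b, 'n) monoid_scheme"
    and d :: nat and \<tau> :: "nat \<Rightarrow> 'a" and \<Phi> :: "(nat \<Rightarrow> 'a) \<Rightarrow> 'a"
  assumes "d \<ge> 2"
    and "cp_monoid M d \<tau> \<Phi>"
    and "nonzero_monoid M"
    and "monoid N"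
    and "finite (carrier N)"
  shows "\<exists>h. h \<in> monoid_hom N M \<and> inj_on h (carrier N)"
proof -
  interpret M: cp_monoid M d \<tau> \<Phi> by (rule assms(2))
  interpret N: monoid N by (rule assms(4))
  obtain S where S: "coordinate_set M S" "finite S" "card (carrier N) < card S"
    using M.ex_large_coordinate_set[OF assms(1,3)] by blast
  then obtain e where e: "e ` carrier N \<subseteq> S" "inj_on e (carrier N)"
    using card_le_inj[OF assms(5) S(2)] by auto
  (* The regular right action, transported along e, with the rest of S fixed. *)
  define act where "act = (\<lambda>a s. if s \<in> e ` carrier N
    then e (inv_into (carrier N) e s \<otimes>\<^bsub>N\<^esub> a) else s)"
  have act_e: "act a (e c) = e (c \<otimes>\<^bsub>N\<^esub> a)" if "c \<in> carrier N" for a c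
    using that e(2) unfolding act_def by simp
  have act_fixed: "act a s = s" if "s \<notin> e ` carrier N" for a s
    using that unfolding act_def by simp
  show ?thesis
  proof (rule faithful_right_action_embeds[OF M.monoid_axioms assms(4) S(1), of act])
    show "act a s \<in> S" if "a \<in> carrier N" "s \<in> S" for a s
      using that act_e act_fixed e(1) by (cases "s \<in> e ` carrier N") auto
    show "act \<one>\<^bsub>N\<^esub> s = s" for s
      using act_e act_fixed by (cases "s \<in> e ` carrier N") auto
    show "act (a \<otimes>\<^bsub>N\<^esub> b) s = act b (act a s)" if "a \<in> carrier N" "b \<in> carrier N" for a b s
      using that act_e act_fixed by (cases "s \<in> e ` carrier N") (auto simp: N.m_assoc)
    show "a = b" if ab: "a \<in> carrier N" "b \<in> carrier N"
      and eq: "\<And>s. s \<in> S \<Longrightarrow> act a s = act b s" for a b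
    proof -
      have "act a (e \<one>\<^bsub>N\<^esub>) = act b (e \<one>\<^bsub>N\<^esub>)" using eq e(1) by blast
      then have "e a = e b" using act_e ab by simp
      then show ?thesis using e(2) ab by (meson inj_onD)
    qed
  qed
qed

end
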